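(* Let $\mathcal X$ be the vertex set of a finite distance-regular graph of diameter $n$ with graph distance $d$, and let $Z\subset\mathcal X$, $|Z|=N$. Let $A_k=\frac1N|\{(z_1,z_2)\in Z^2: d(z_1,z_2)=k\}|$, $k=1,\dots,n$. Then $$D^{L_2}(Z)=\frac12\Big(\frac1{|\mathcal X|}\sum_{i,j=0}^n\sum_{k=|i-j|}^{i+j}n_kp_{ij}^k|i-j|-\frac1N\sum_{k=1}^nA_k\sum_{\substack{i,j\\|i-j|\le k\le i+j}}p_{ij}^k|i-j|\Big),$$ where terms with $k>n$ are zero.
   Context: For $x,y$ with $d(x,y)=k$, the intersection number $p_{ij}^k=|\{u\in\mathcal X:d(x,u)=i,\ d(y,u)=j\}|$ depends only on $k$ (distance-regularity); $n_k=|\{u:d(x,u)=k\}|$ is the valency. $B(x,t)=\{y:d(x,y)\le t\}$ and $D^{L_2}(Z)=\sum_{t=0}^n\sum_{x\in\mathcal X}\Big(\frac1N\sum_{z\in Z}\mathbb 1_{B(x,t)}(z)-\frac{|B(x,t)|}{|\mathcal X|}\Big)^2$. *)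

theory Defs
  imports "Graph_Theory.Graph_Theory" "HOL-Library.Indicator_Function"
begin

text \<open>
  A finite simple undirected graph is rendered as a term satisfying the locale \<open>graph\<close>
  (finite, symmetric, no loops, no parallel arcs).  The distance is the length of a shortest walk;
  on graphs that are not connected the value for unreachable pairs is unspecified.
\<close>

definition graph_dist :: "('a, 'b) pre_digraph \<Rightarrow> 'a \<Rightarrow> 'a \<Rightarrow> nat" where
  "graph_dist G x y = (LEAST l. \<exists>p. pre_digraph.awalk G x p y \<and> length p = l)"

definition graph_diameter :: "('a, 'b) pre_digraph \<Rightarrow> nat" where
  "graph_diameter G = Max {graph_dist G x y | x y. x \<in> verts G \<and> y \<in> verts G}"

definition sphere_inter :: "('a, 'b) pre_digraph \<Rightarrow> 'a \<Rightarrow> 'a \<Rightarrow> nat \<Rightarrow> nat \<Rightarrow> 'a set" where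
  "sphere_inter G x y i j = {u \<in> verts G. graph_dist G x u = i \<and> graph_dist G y u = j}"

text \<open>The qualified name avoids the topological notion of connectedness; it includes
  that there is at least one vertex.\<close>

locale distance_regular_graph = graph G for G :: "('a, 'b) pre_digraph" +
  assumes connected_graph: "Digraph_Component.connected G"
    and distance_regular:
      "\<lbrakk>x \<in> verts G; y \<in> verts G; x' \<in> verts G; y' \<in> verts G;
        graph_dist G x y = graph_dist G x' y'\<rbrakk>
       \<Longrightarrow> card (sphere_inter G x y i j) = card (sphere_inter G x' y' i j)"

text \<open>\<open>intersection_number G i j k\<close> is $p_{ij}^k$, with the convention that it vanishes
  when $k$ exceeds the diameter.\<close>

definition intersection_number :: "('a, 'b) pre_digraph \<Rightarrow> nat \<Rightarrow> nat \<Rightarrow> nat \<Rightarrow> nat" where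
  "intersection_number G i j k =
     (if k \<le> graph_diameter G
      then (THE m. \<forall>x \<in> verts G. \<forall>y \<in> verts G.
              graph_dist G x y = k \<longrightarrow> card (sphere_inter G x y i j) = m)
      else 0)"

definition valency :: "('a, 'b) pre_digraph \<Rightarrow> nat \<Rightarrow> nat" where
  "valency G k = (THE m. \<forall>x \<in> verts G. card {u \<in> verts G. graph_dist G x u = k} = m)"

definition graph_ball :: "('a, 'b) pre_digraph \<Rightarrow> 'a \<Rightarrow> nat \<Rightarrow> 'a set" where
  "graph_ball G x t = {y \<in> verts G. graph_dist G x y \<le> t}"

definition L2_discrepancy :: "('a, 'b) pre_digraph \<Rightarrow> 'a set \<Rightarrow> real" where
  "L2_discrepancy G Z =
     (\<Sum>t = 0..graph_diameter G. \<Sum>x \<in> verts G.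
        (1 / real (card Z) * (\<Sum>z \<in> Z. indicator (graph_ball G x t) z)
         - real (card (graph_ball G x t)) / real (card (verts G)))\<^sup>2)"

definition distance_distribution :: "('a, 'b) pre_digraph \<Rightarrow> 'a set \<Rightarrow> nat \<Rightarrow> real" where
  "distance_distribution G Z k =
     1 / real (card Z) * real (card {(z1, z2) \<in> Z \<times> Z. graph_dist G z1 z2 = k})"

context distance_regular_graph
begin

lemma graph_dist_le_diameter:
  assumes "x \<in> verts G" "y \<in> verts G"
  shows "graph_dist G x y \<le> graph_diameter G"
proof -
  have "{graph_dist G x y | x y. x \<in> verts G \<and> y \<in> verts G}
      = (\<lambda>(x, y). graph_dist G x y) ` (verts G \<times> verts G)"
    by auto
  then have "finite {graph_dist G x y | x y. x \<in> verts G \<and> y \<in> verts G}"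
    by simp
  then show ?thesis
    unfolding graph_diameter_def using assms by (intro Max_ge) auto
qed

lemma intersection_number_eq:
  assumes "x \<in> verts G" "y \<in> verts G"
  shows "intersection_number G i j (graph_dist G x y) = card (sphere_inter G x y i j)"
proof -
  have "(THE m. \<forall>x' \<in> verts G. \<forall>y' \<in> verts G. graph_dist G x' y' = graph_dist G x y \<longrightarrow>
          card (sphere_inter G x' y' i j) = m) = card (sphere_inter G x y i j)"
  proof (rule the_equality)
    show "\<forall>x' \<in> verts G. \<forall>y' \<in> verts G. graph_dist G x' y' = graph_dist G x y \<longrightarrow>
        card (sphere_inter G x' y' i j) = card (sphere_inter G x y i j)"
      using distance_regular assms by blast
  qed (use assms in blast)
  then show ?thesis
    unfolding intersection_number_def using graph_dist_le_diameter[OF assms] by simp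
qed

lemma graph_dist_self:
  assumes "x \<in> verts G"
  shows "graph_dist G x x = 0"
  unfolding graph_dist_def using assms by (intro Least_eq_0) (auto simp: awalk_Nil_iff)

lemma valency_eq:
  assumes "x \<in> verts G"
  shows "valency G k = card {u \<in> verts G. graph_dist G x u = k}"
  unfolding valency_def
proof (rule the_equality)
  have "card (sphere_inter G x' x' k k) = card (sphere_inter G x x k k)" if "x' \<in> verts G" for x'
    using distance_regular[OF that that assms assms] graph_dist_self that assms by simp
  then show "\<forall>x' \<in> verts G. card {u \<in> verts G. graph_dist G x' u = k}
      = card {u \<in> verts G. graph_dist G x u = k}"
    by (simp add: sphere_inter_def)
qed (use assms in auto)

end

end

theory Submission
  imports Defs
begin

text \<open>
  The discrepancy is a quadratic form: it is the sum of squares of the integrals of ball indicators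
  against the signed measure \<open>a = 1\<^sub>Z/N - 1/|X|\<close> of total mass zero. Summing the product of
  two ball indicators over all radii \<open>t \<le> n\<close> gives
  \<open>n + 1 - max (d(x,z)) (d(x,w))\<close>, and
  \<open>max p q = (p + q + |p - q|)/2\<close>. In a distance-regular graph the sum of \<open>d(x,z)\<close> over \<open>x\<close>
  is independent of \<open>z\<close>, so only the kernel \<open>\<lambda>(z,w) = (\<Sum>x. |d(x,z) - d(x,w)|)/2\<close>
  survives, with a minus sign. The average of \<open>\<lambda>(z,w)\<close> over \<open>w\<close> is again independent
  of \<open>z\<close>, so the form collapses to the average of \<open>\<lambda>\<close> over all pairs of vertices minus its
  average over \<open>Z \<times> Z\<close>. Finally \<open>2\<lambda>(z,w)\<close> is the sum of \<open>p\<^sub>i\<^sub>j\<^sup>k |i - j|\<close> over \<open>i, j\<close>,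
  where \<open>k = d(z,w)\<close>.
\<close>

section \<open>Sums over radii of products of ball indicators\<close>

lemma sum_threshold_indicators:
  fixes p q n :: nat
  assumes "p \<le> n" "q \<le> n"
  shows "(\<Sum>t = 0..n. of_bool (p \<le> t) * of_bool (q \<le> t))
    = real n + 1 - (real p + real q) / 2 - \<bar>real p - real q\<bar> / 2"
proof -
  have "(\<Sum>t = 0..n. of_bool (p \<le> t) * of_bool (q \<le> t) :: real)
      = (\<Sum>t = 0..n. of_bool (t \<in> {max p q..n}))"
    by (intro sum.cong) auto
  also have "\<dots> = real (card {max p q..n})"
    by (simp add: of_bool_def sum.If_cases Int_def del: card_atLeastAtMost)
      (rule arg_cong[where f = card], auto)
  also have "\<dots> = real n + 1 - max (real p) (real q)"
    using assms by (simp add: of_nat_diff max_def)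
  also have "max (real p) (real q) = (real p + real q) / 2 + \<bar>real p - real q\<bar> / 2"
    by (simp add: max_def abs_if field_simps)
  finally show ?thesis by simp
qed

lemma sum_squares_thresholds_eq_energy:
  fixes \<delta> :: "'a \<Rightarrow> 'a \<Rightarrow> nat" and a :: "'a \<Rightarrow> real"
  assumes bound: "\<And>x y. x \<in> V \<Longrightarrow> y \<in> V \<Longrightarrow> \<delta> x y \<le> n"
    and transmission: "\<And>z. z \<in> V \<Longrightarrow> (\<Sum>x\<in>V. real (\<delta> x z)) = S"
    and mass_zero: "(\<Sum>z\<in>V. a z) = 0"
  shows "(\<Sum>t = 0..n. \<Sum>x\<in>V. (\<Sum>z\<in>V. a z * of_bool (\<delta> x z \<le> t))\<^sup>2)
    = - (\<Sum>z\<in>V. \<Sum>w\<in>V. a z * a w * (\<Sum>x\<in>V. \<bar>real (\<delta> x z) - real (\<delta> x w)\<bar>)) / 2"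
proof -
  define L where "L z w = (\<Sum>x\<in>V. \<bar>real (\<delta> x z) - real (\<delta> x w)\<bar>)" for z w
  \<comment> \<open>Everything in the kernel that does not depend on the pair: each of the centres
    \<open>x\<close> gives \<open>n + 1\<close>, and the two transmissions give \<open>S / 2\<close>
    each.\<close>
  define c where "c = (real n + 1) * real (card V) - S"
  have kernel: "(\<Sum>t = 0..n. \<Sum>x\<in>V. of_bool (\<delta> x z \<le> t) * of_bool (\<delta> x w \<le> t)) = c - L z w / 2"
    if "z \<in> V" "w \<in> V" for z w
  proof -
    have "(\<Sum>t = 0..n. \<Sum>x\<in>V. of_bool (\<delta> x z \<le> t) * of_bool (\<delta> x w \<le> t))
       = (\<Sum>x\<in>V. real n + 1 - (real (\<delta> x z) + real (\<delta> x w)) / 2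
            - \<bar>real (\<delta> x z) - real (\<delta> x w)\<bar> / 2)"
      by (subst sum.swap) (intro sum.cong refl sum_threshold_indicators bound that)
    also have "\<dots> = (real n + 1) * real (card V)
        - ((\<Sum>x\<in>V. real (\<delta> x z)) + (\<Sum>x\<in>V. real (\<delta> x w))) / 2 - L z w / 2"
      by (simp add: L_def sum_subtractf sum.distrib mult.commute flip: sum_divide_distrib)
    finally show ?thesis
      using that by (simp add: transmission c_def)
  qed
  have "(\<Sum>t = 0..n. \<Sum>x\<in>V. (\<Sum>z\<in>V. a z * of_bool (\<delta> x z \<le> t))\<^sup>2)
      = (\<Sum>t = 0..n. \<Sum>x\<in>V. \<Sum>z\<in>V. \<Sum>w\<in>V.
           a z * a w * (of_bool (\<delta> x z \<le> t) * of_bool (\<delta> x w \<le> t)))"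
    by (simp only: power2_eq_square sum_product ac_simps)
  also have "\<dots> = (\<Sum>t = 0..n. \<Sum>z\<in>V. \<Sum>w\<in>V. \<Sum>x\<in>V.
           a z * a w * (of_bool (\<delta> x z \<le> t) * of_bool (\<delta> x w \<le> t)))"
    by (rule sum.cong[OF refl], rule trans[OF sum.swap], rule sum.cong[OF refl], rule sum.swap)
  also have "\<dots> = (\<Sum>z\<in>V. \<Sum>w\<in>V. \<Sum>t = 0..n. \<Sum>x\<in>V.
           a z * a w * (of_bool (\<delta> x z \<le> t) * of_bool (\<delta> x w \<le> t)))"
    by (rule trans[OF sum.swap], rule sum.cong[OF refl], rule sum.swap)
  also have "\<dots> = (\<Sum>z\<in>V. \<Sum>w\<in>V. a z * a w * (c - L z w / 2))"
    by (intro sum.cong refl) (simp only: kernel flip: sum_distrib_left)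
  \<comment> \<open>The constant \<open>c\<close> multiplies the square of the total mass, so it
    disappears and only the absolute differences remain.\<close>
  also have "\<dots> = c * ((\<Sum>z\<in>V. a z) * (\<Sum>w\<in>V. a w)) - (\<Sum>z\<in>V. \<Sum>w\<in>V. a z * a w * L z w) / 2"
    by (simp add: sum_product sum_distrib_left sum_divide_distrib sum_subtractf algebra_simps)
  finally show ?thesis
    by (simp add: mass_zero L_def)
qed

section \<open>Graph distance as a metric\<close>

context distance_regular_graph
begin

text \<open>Arcs are abstract objects with a fixed tail and head, so reversing the list is not
  enough: symmetry supplies an opposite arc for each arc, and these are joined in reverse
  order.\<close>

lemma awalk_reverse:
  assumes "awalk u p v"
  shows "\<exists>q. awalk v q u \<and> length q = length p"
  using assms
proof (induction p arbitrary: u)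
  case Nil
  then show ?case by (auto simp: awalk_Nil_iff)
next
  case (Cons e p)
  then have e: "e \<in> arcs G" "tail G e = u" and p: "awalk (head G e) p v"
    by (auto simp: awalk_Cons_iff)
  obtain q where q: "awalk v q (head G e)" "length q = length p"
    using Cons.IH[OF p] by blast
  have "u \<rightarrow>\<^bsub>G\<^esub> head G e"
    using e by (auto simp: arcs_ends_def arc_to_ends_def)
  then have "head G e \<rightarrow>\<^bsub>G\<^esub> u"
    by (rule graph_symmetric)
  then obtain f where "f \<in> arcs G" "tail G f = head G e" "head G f = u"
    by (auto simp: arcs_ends_def arc_to_ends_def)
  then have "awalk (head G e) [f] u"
    by (auto simp: awalk_Cons_iff awalk_Nil_iff)
  with q have "awalk v (q @ [f]) u" "length (q @ [f]) = length (e # p)"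
    by (auto intro: awalk_appendI)
  then show ?case by blast
qed

lemma graph_dist_commute: "graph_dist G x y = graph_dist G y x"
proof -
  have "(\<exists>p. awalk x p y \<and> length p = l) \<longleftrightarrow> (\<exists>p. awalk y p x \<and> length p = l)" for l
    by (metis awalk_reverse)
  then show ?thesis
    by (simp add: graph_dist_def)
qed

text \<open>A symmetric connected digraph is strongly connected, so some walk exists and the
  \<open>LEAST\<close> in the distance is attained.\<close>

lemma graph_dist_awalk:
  assumes "x \<in> verts G" "y \<in> verts G"
  obtains p where "awalk x p y" "length p = graph_dist G x y"
proof -
  have "x \<rightarrow>\<^sup>*\<^bsub>G\<^esub> y"
    using connected_graph assms symmetric_connected_imp_strongly_connected
    by (auto intro: sym_arcs)
  then obtain p where "awalk x p y"
    using reachable_awalk by blast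
  then have "\<exists>l p. awalk x p y \<and> length p = l" by blast
  from LeastI_ex[OF this] show thesis
    using that by (auto simp: graph_dist_def)
qed

lemma graph_dist_le_length: "awalk x p y \<Longrightarrow> graph_dist G x y \<le> length p"
  unfolding graph_dist_def by (rule Least_le) blast

lemma graph_dist_triangle:
  assumes "x \<in> verts G" "y \<in> verts G" "z \<in> verts G"
  shows "graph_dist G x z \<le> graph_dist G x y + graph_dist G y z"
proof -
  obtain p q where p: "awalk x p y" "length p = graph_dist G x y"
    and q: "awalk y q z" "length q = graph_dist G y z"
    using assms by (metis graph_dist_awalk)
  show ?thesis
    using graph_dist_le_length[OF awalk_appendI[OF p(1) q(1)]] p(2) q(2) by simp
qed

section \<open>Intersection numbers and counting by distance\<close>

lemma intersection_number_eq_0: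
  assumes "\<not> (\<bar>int i - int j\<bar> \<le> int k \<and> k \<le> i + j)" "x \<in> verts G" "y \<in> verts G" "graph_dist G x y = k"
  shows "intersection_number G i j k = 0"
proof -
  have "sphere_inter G x y i j = {}"
  proof (rule ccontr)
    assume "sphere_inter G x y i j \<noteq> {}"
    then obtain u where "u \<in> verts G" "graph_dist G x u = i" "graph_dist G y u = j"
      by (auto simp: sphere_inter_def)
    \<comment> \<open>The three triangle inequalities for \<open>x\<close>, \<open>y\<close>,
      \<open>u\<close> say exactly k \<le> i + j, i \<le> k + j and j \<le> k + i.\<close>
    then show False
      using assms graph_dist_triangle[of x u y] graph_dist_triangle[of x y u]
        graph_dist_triangle[of y x u] graph_dist_commute[of u y] graph_dist_commute[of y x]
      by auto
  qed
  then show ?thesis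
    using intersection_number_eq[of x y i j] assms by simp
qed

text \<open>Sort the vertices \<open>u\<close> by their pair of distances to \<open>x\<close> and
  \<open>y\<close>: the fibre over \<open>(i, j)\<close> is \<open>sphere_inter G x y i j\<close>,
  whose size is the intersection number.\<close>

lemma sum_intersection_number:
  fixes g :: "nat \<Rightarrow> nat \<Rightarrow> real"
  assumes "x \<in> verts G" "y \<in> verts G"
  shows "(\<Sum>i = 0..graph_diameter G. \<Sum>j = 0..graph_diameter G.
      real (intersection_number G i j (graph_dist G x y)) * g i j)
    = (\<Sum>u\<in>verts G. g (graph_dist G x u) (graph_dist G y u))"
proof -
  let ?T = "{0..graph_diameter G} \<times> {0..graph_diameter G}"
  let ?h = "\<lambda>u. (graph_dist G x u, graph_dist G y u)"
  have fibre: "{u \<in> verts G. ?h u = (i, j)} = sphere_inter G x y i j" for i j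
    by (auto simp: sphere_inter_def)
  have "(\<Sum>u\<in>verts G. case_prod g (?h u))
      = (\<Sum>b\<in>?T. \<Sum>u\<in>{u \<in> verts G. ?h u = b}. case_prod g (?h u))"
    using assms by (intro sum.group[symmetric]) (auto simp: graph_dist_le_diameter)
  also have "\<dots> = (\<Sum>b\<in>?T. \<Sum>u\<in>{u \<in> verts G. ?h u = b}. case_prod g b)"
    by (intro sum.cong refl) auto
  also have "\<dots> = (\<Sum>(i, j)\<in>?T. real (intersection_number G i j (graph_dist G x y)) * g i j)"
    by (intro sum.cong refl) (auto simp: fibre[simplified] intersection_number_eq assms)
  finally show ?thesis
    by (simp add: sum.cartesian_product)
qed

lemma sum_valency:
  fixes g :: "nat \<Rightarrow> real"
  assumes "x \<in> verts G"
  shows "(\<Sum>k = 0..graph_diameter G. real (valency G k) * g k) = (\<Sum>u\<in>verts G. g (graph_dist G x u))"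
proof -
  have "(\<Sum>u\<in>verts G. g (graph_dist G x u))
      = (\<Sum>k = 0..graph_diameter G. \<Sum>u\<in>{u \<in> verts G. graph_dist G x u = k}. g (graph_dist G x u))"
    using assms by (intro sum.group[symmetric]) (auto simp: graph_dist_le_diameter)
  also have "\<dots> = (\<Sum>k = 0..graph_diameter G. real (valency G k) * g k)"
    by (intro sum.cong refl) (simp add: valency_eq[OF assms])
  finally show ?thesis ..
qed

lemma sum_distance_distribution:
  fixes g :: "nat \<Rightarrow> real"
  assumes "Z \<subseteq> verts G"
  shows "(\<Sum>k = 0..graph_diameter G. distance_distribution G Z k * g k)
    = 1 / real (card Z) * (\<Sum>z\<in>Z. \<Sum>w\<in>Z. g (graph_dist G z w))"
proof -
  have fin: "finite Z" using assms by (rule finite_subset) simp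
  have "(\<Sum>z\<in>Z. \<Sum>w\<in>Z. g (graph_dist G z w)) = (\<Sum>b\<in>Z \<times> Z. g (case_prod (graph_dist G) b))"
    by (simp add: sum.cartesian_product case_prod_beta)
  also have "\<dots> = (\<Sum>k = 0..graph_diameter G.
      \<Sum>b\<in>{b \<in> Z \<times> Z. case_prod (graph_dist G) b = k}. g (case_prod (graph_dist G) b))"
    using assms fin by (intro sum.group[symmetric]) (auto intro!: graph_dist_le_diameter)
  also have "\<dots> = (\<Sum>k = 0..graph_diameter G.
      real (card {(z1, z2) \<in> Z \<times> Z. graph_dist G z1 z2 = k}) * g k)"
    by (intro sum.cong refl) (auto simp: case_prod_beta intro!: arg_cong[where f = card])
  finally show ?thesis
    by (simp add: distance_distribution_def sum_distrib_left)
qed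

text \<open>Cut a shortest walk between two vertices at maximal distance after \<open>k\<close>
  arcs. This makes every intersection number with \<open>k\<close> up to the diameter an actual
  count.\<close>

lemma exists_graph_dist:
  assumes "k \<le> graph_diameter G"
  obtains x y where "x \<in> verts G" "y \<in> verts G" "graph_dist G x y = k"
proof -
  have "{graph_dist G x y | x y. x \<in> verts G \<and> y \<in> verts G}
      = (\<lambda>(x, y). graph_dist G x y) ` (verts G \<times> verts G)"
    by auto
  moreover have "verts G \<noteq> {}"
    using connected_graph by (auto simp: Digraph_Component.connected_def strongly_connected_def)
  ultimately have "graph_diameter G \<in> (\<lambda>(x, y). graph_dist G x y) ` (verts G \<times> verts G)"
    unfolding graph_diameter_def by (simp only:) (rule Max_in, auto)
  then obtain x y where xy: "x \<in> verts G" "y \<in> verts G" "graph_dist G x y = graph_diameter G"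
    by auto
  obtain p where p: "awalk x p y" "length p = graph_diameter G"
    using graph_dist_awalk[OF xy(1,2)] xy(3) by metis
  then obtain u where u: "awalk x (take k p) u" "awalk u (drop k p) y"
    using awalk_append_iff[of x "take k p" "drop k p" y] by auto
  then have "u \<in> verts G" by auto
  have "graph_dist G x u \<le> k" "graph_dist G u y \<le> graph_diameter G - k"
    using graph_dist_le_length[OF u(1)] graph_dist_le_length[OF u(2)] p assms by auto
  \<comment> \<open>The two pieces have distances at most \<open>k\<close> and \<open>n - k\<close>,
    while their sum is at least the diameter \<open>n\<close>, so both bounds are
    equalities.\<close>
  then have "graph_dist G x u = k"
    using graph_dist_triangle[OF xy(1) \<open>u \<in> verts G\<close> xy(2)] xy(3) assms by linarith
  then show thesis
    using that xy \<open>u \<in> verts G\<close> by blast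
qed

section \<open>The energy kernel as a function of distance\<close>

definition energy_kernel :: "nat \<Rightarrow> real" where
  "energy_kernel k = (\<Sum>i = 0..graph_diameter G. \<Sum>j = 0..graph_diameter G.
     real (intersection_number G i j k) * \<bar>real i - real j\<bar>)"

text \<open>This identifies the kernel with 2\<lambda> of the overview. Since it depends on the
  distance alone, sums of it can be grouped by distance classes.\<close>

lemma energy_kernel_graph_dist:
  assumes "x \<in> verts G" "y \<in> verts G"
  shows "energy_kernel (graph_dist G x y)
    = (\<Sum>u\<in>verts G. \<bar>real (graph_dist G u x) - real (graph_dist G u y)\<bar>)"
  unfolding energy_kernel_def sum_intersection_number[OF assms]
  by (intro sum.cong refl) (metis graph_dist_commute)

lemma energy_kernel_triangle:
  assumes "k \<le> graph_diameter G"
  shows "(\<Sum>(i, j) \<in> {(i, j). i \<le> graph_diameter G \<and> j \<le> graph_diameter G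
      \<and> \<bar>int i - int j\<bar> \<le> int k \<and> k \<le> i + j}.
      real (intersection_number G i j k) * \<bar>real i - real j\<bar>) = energy_kernel k"
proof -
  obtain x y where "x \<in> verts G" "y \<in> verts G" "graph_dist G x y = k"
    using exists_graph_dist[OF assms] .
  then show ?thesis
    unfolding energy_kernel_def sum.cartesian_product
    by (intro sum.mono_neutral_left) (auto dest: intersection_number_eq_0[rotated])
qed

lemma energy_kernel_valency_sum:
  "(\<Sum>i = 0..graph_diameter G. \<Sum>j = 0..graph_diameter G. \<Sum>k = nat \<bar>int i - int j\<bar>..i + j.
      real (valency G k) * real (intersection_number G i j k) * \<bar>real i - real j\<bar>)
    = (\<Sum>k = 0..graph_diameter G. real (valency G k) * energy_kernel k)"
proof -
  let ?n = "graph_diameter G"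
  have "(\<Sum>k = nat \<bar>int i - int j\<bar>..i + j.
      real (valency G k) * real (intersection_number G i j k) * \<bar>real i - real j\<bar>)
    = (\<Sum>k = 0..?n. real (valency G k) * real (intersection_number G i j k) * \<bar>real i - real j\<bar>)"
    for i j
  \<comment> \<open>Both ranges may contain indices missing from the other: those k \<le> n outside
    the triangle range vanish by the triangle inequality, those above \<open>n\<close> by the
    convention in \<open>intersection_number\<close>.\<close>
  proof (rule sum.mono_neutral_cong)
    fix k assume k: "k \<in> {0..?n} - {nat \<bar>int i - int j\<bar>..i + j}"
    then obtain x y where "x \<in> verts G" "y \<in> verts G" "graph_dist G x y = k"
      using exists_graph_dist[of k] by auto
    then have "intersection_number G i j k = 0"
      using k by (intro intersection_number_eq_0) auto
    then show "real (valency G k) * real (intersection_number G i j k) * \<bar>real i - real j\<bar> = 0"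
      by simp
  qed (auto simp: intersection_number_def)
  then have "(\<Sum>i = 0..?n. \<Sum>j = 0..?n. \<Sum>k = nat \<bar>int i - int j\<bar>..i + j.
      real (valency G k) * real (intersection_number G i j k) * \<bar>real i - real j\<bar>)
    = (\<Sum>i = 0..?n. \<Sum>j = 0..?n. \<Sum>k = 0..?n.
      real (valency G k) * real (intersection_number G i j k) * \<bar>real i - real j\<bar>)"
    by simp
  also have "\<dots> = (\<Sum>i = 0..?n. \<Sum>k = 0..?n. \<Sum>j = 0..?n.
      real (valency G k) * real (intersection_number G i j k) * \<bar>real i - real j\<bar>)"
    by (intro sum.cong refl sum.swap)
  also have "\<dots> = (\<Sum>k = 0..?n. \<Sum>i = 0..?n. \<Sum>j = 0..?n.
      real (valency G k) * real (intersection_number G i j k) * \<bar>real i - real j\<bar>)"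
    by (rule sum.swap)
  finally show ?thesis
    by (simp add: energy_kernel_def sum_distrib_left mult.assoc)
qed

section \<open>Collapse of the quadratic form and the final formula\<close>

theorem L2_discrepancy_eq_energy:
  assumes Z: "Z \<subseteq> verts G" and "Z \<noteq> {}"
  shows "L2_discrepancy G Z = 1 / 2 *
    (1 / real (card (verts G)) * (\<Sum>k = 0..graph_diameter G. real (valency G k) * energy_kernel k)
     - 1 / real (card Z) * (\<Sum>k = 0..graph_diameter G. distance_distribution G Z k * energy_kernel k))"
proof -
  let ?V = "verts G" and ?n = "graph_diameter G" and ?d = "graph_dist G"
  define M where "M = real (card ?V)"
  define N where "N = real (card Z)"
  define a where "a z = of_bool (z \<in> Z) / N - 1 / M" for z
  define E where "E = (\<Sum>k = 0..?n. real (valency G k) * energy_kernel k)"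
  have "finite Z"
    using Z by (rule finite_subset) simp
  moreover have "?V \<noteq> {}"
    using assms by auto
  ultimately have M: "M \<noteq> 0" and N: "N \<noteq> 0"
    using assms by (auto simp: M_def N_def)
  have integral: "(\<Sum>z\<in>?V. a z * f z) = (\<Sum>z\<in>Z. f z) / N - (\<Sum>z\<in>?V. f z) / M" for f :: "'a \<Rightarrow> real"
  proof -
    have "(\<Sum>z\<in>?V. of_bool (z \<in> Z) * f z) = (\<Sum>z\<in>Z. f z)"
      using Z by (intro sum.mono_neutral_cong_right) auto
    then show ?thesis
      by (simp add: a_def left_diff_distrib sum_subtractf flip: sum_divide_distrib)
  qed
  \<comment> \<open>Grouping \<open>w\<close> by its distance from \<open>z\<close> gives valencies,
    which do not depend on \<open>z\<close>; hence every row sum is \<open>E\<close>.\<close>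
  have rowE: "(\<Sum>w\<in>?V. energy_kernel (?d z w)) = E" if "z \<in> ?V" for z
    using sum_valency[OF that] by (simp add: E_def)
  have colE: "(\<Sum>z\<in>?V. energy_kernel (?d z w)) = E" if "w \<in> ?V" for w
    using rowE[OF that] by (simp add: graph_dist_commute[of _ w])
  have "L2_discrepancy G Z = (\<Sum>t = 0..?n. \<Sum>x\<in>?V. (\<Sum>z\<in>?V. a z * of_bool (?d x z \<le> t))\<^sup>2)"
    unfolding L2_discrepancy_def
  proof (intro sum.cong refl arg_cong[where f = "\<lambda>r. r\<^sup>2"])
    fix t x
    have "(\<Sum>z\<in>Z. indicator (graph_ball G x t) z) = (\<Sum>z\<in>Z. of_bool (?d x z \<le> t) :: real)"
      using Z by (intro sum.cong) (auto simp: graph_ball_def)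
    moreover have "real (card (graph_ball G x t)) = (\<Sum>z\<in>?V. of_bool (?d x z \<le> t))"
      by (simp add: graph_ball_def of_bool_def sum.If_cases Int_def)
    ultimately show "1 / real (card Z) * (\<Sum>z\<in>Z. indicator (graph_ball G x t) z)
        - real (card (graph_ball G x t)) / real (card ?V) = (\<Sum>z\<in>?V. a z * of_bool (?d x z \<le> t))"
      by (simp add: integral M_def N_def)
  qed
  also have "\<dots> = - (\<Sum>z\<in>?V. \<Sum>w\<in>?V. a z * a w * (\<Sum>x\<in>?V. \<bar>real (?d x z) - real (?d x w)\<bar>)) / 2"
  proof (rule sum_squares_thresholds_eq_energy)
    show "(\<Sum>x\<in>?V. real (?d x z)) = (\<Sum>k = 0..?n. real (valency G k) * real k)" if "z \<in> ?V" for z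
      using sum_valency[OF that, of real] by (simp add: graph_dist_commute[of z])
    show "(\<Sum>z\<in>?V. a z) = 0"
      using integral[of "\<lambda>_. 1"] M N by (simp add: M_def N_def)
  qed (rule graph_dist_le_diameter)
  also have "(\<Sum>z\<in>?V. \<Sum>w\<in>?V. a z * a w * (\<Sum>x\<in>?V. \<bar>real (?d x z) - real (?d x w)\<bar>))
      = (\<Sum>z\<in>?V. a z * (\<Sum>w\<in>?V. a w * energy_kernel (?d z w)))"
    by (simp add: energy_kernel_graph_dist sum_distrib_left mult.assoc)
  also have "\<dots> = (\<Sum>z\<in>?V. a z * ((\<Sum>w\<in>Z. energy_kernel (?d z w)) / N - E / M))"
    by (intro sum.cong refl) (simp add: integral rowE)
  also have "\<dots> = (\<Sum>z\<in>Z. \<Sum>w\<in>Z. energy_kernel (?d z w)) / N / N - E / M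
      - ((\<Sum>z\<in>?V. \<Sum>w\<in>Z. energy_kernel (?d z w)) / N / M - E / M)"
    using M N by (simp add: integral sum_subtractf diff_divide_distrib flip: sum_divide_distrib)
      (simp add: M_def N_def)
  \<comment> \<open>The mixed term therefore equals \<open>E / M\<close> and cancels inside the
    bracket, leaving the mean over \<open>Z\<close> minus \<open>E / M\<close>.\<close>
  also have "(\<Sum>z\<in>?V. \<Sum>w\<in>Z. energy_kernel (?d z w)) = N * E"
    using Z by (subst sum.swap) (simp add: colE subset_iff N_def)
  also have "(\<Sum>z\<in>Z. \<Sum>w\<in>Z. energy_kernel (?d z w))
      = N * (\<Sum>k = 0..?n. distance_distribution G Z k * energy_kernel k)"
    using N by (simp add: sum_distance_distribution[OF Z] N_def)
  finally show ?thesis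
    using M N by (simp add: E_def M_def N_def field_simps)
qed

end

theorem theorem6p4:
  fixes G :: "('a, 'b) pre_digraph" and Z :: "'a set" and n N :: nat
  assumes "distance_regular_graph G"
    and "n = graph_diameter G"
    and "Z \<subseteq> verts G"
    and "card Z = N"
    and "N > 0"
  shows "L2_discrepancy G Z =
    1 / 2 *
      (1 / real (card (verts G)) *
         (\<Sum>i = 0..n. \<Sum>j = 0..n. \<Sum>k = nat \<bar>int i - int j\<bar>..i + j.
            real (valency G k) * real (intersection_number G i j k) * \<bar>real i - real j\<bar>)
       - 1 / real N *
         (\<Sum>k = 1..n. distance_distribution G Z k *
            (\<Sum>(i, j) \<in> {(i, j). i \<le> n \<and> j \<le> n \<and> \<bar>int i - int j\<bar> \<le> int k \<and> k \<le> i + j}.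
               real (intersection_number G i j k) * \<bar>real i - real j\<bar>)))"
proof -
  interpret distance_regular_graph G by fact
  have "Z \<noteq> {}" using assms by auto
  then obtain z where z: "z \<in> verts G" using assms by auto
  \<comment> \<open>The diagonal pairs of \<open>Z\<close> carry no energy, so the sum over
    distances may start at 1.\<close>
  have "energy_kernel 0 = 0"
    using energy_kernel_graph_dist[OF z z] by (simp add: graph_dist_self z)
  then have "(\<Sum>k = 0..n. distance_distribution G Z k * energy_kernel k)
      = (\<Sum>k = 1..n. distance_distribution G Z k * energy_kernel k)"
    by (simp add: sum.atLeast_Suc_atMost)
  then show ?thesis
    using L2_discrepancy_eq_energy[OF assms(3) \<open>Z \<noteq> {}\<close>] assms
    by (simp add: energy_kernel_triangle energy_kernel_valency_sum)
qed

end
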